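(* Let $\mathcal{A}$ be a unital Banach algebra with unit $1$ and let $b,c\in\mathcal{A}$. Then the set $\mathcal{A}^{-(b,c)}=\{a\in\mathcal{A}: a^{-(b,c)}\text{ exists}\}$ is open in $\mathcal{A}$. Furthermore, if $b,c\in\hat{\mathcal{A}}\setminus\{0\}$, $a\in\mathcal{A}^{-(b,c)}$ and $e\in\mathcal{A}$ is such that $\|e\|<\frac{1}{\|a^{-(b,c)}\|}$, then $a+e\in\mathcal{A}^{-(b,c)}$ and $$(a+e)^{-(b,c)}=(1+a^{-(b,c)}e)^{-1}a^{-(b,c)}=a^{-(b,c)}(1+ea^{-(b,c)})^{-1}.$$
   Context: The unit satisfies $\|1\|=1$. $\hat{\mathcal{A}}$ is the set of regular elements of $\mathcal{A}$, i.e. those $x$ with $x=xyx$ for some $y\in\mathcal{A}$. For $b,c\in\mathcal{A}$, an element $a\in\mathcal{A}$ is $(b,c)$-invertible if there exists $y\in\mathcal{A}$ such that $y\in (b\mathcal{A}y)\cap(y\mathcal{A}c)$, $b=yab$ and $c=cay$; such $y$ is unique when it exists and is denoted $a^{-(b,c)}$. (If $b,c\neq 0$ then $a^{-(b,c)}\neq0$ whenever it exists.) *)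

theory Defs
  imports "HOL-Analysis.Analysis"
begin

definition regular_elements :: "'a::semigroup_mult set" where
  "regular_elements = {x. \<exists>y. x = x * y * x}"

definition is_bc_inverse :: "'a::semigroup_mult \<Rightarrow> 'a \<Rightarrow> 'a \<Rightarrow> 'a \<Rightarrow> bool" where
  "is_bc_inverse b c a y \<longleftrightarrow>
     y \<in> {b * x * y | x. True} \<inter> {y * x * c | x. True} \<and> b = y * a * b \<and> c = c * a * y"

definition bc_invertibles :: "'a::semigroup_mult \<Rightarrow> 'a \<Rightarrow> 'a set" where
  "bc_invertibles b c = {a. \<exists>y. is_bc_inverse b c a y}"

text \<open>Unspecified when \<open>a\<close> is not in \<open>bc_invertibles b c\<close>.\<close>

definition bc_inverse :: "'a::semigroup_mult \<Rightarrow> 'a \<Rightarrow> 'a \<Rightarrow> 'a" where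
  "bc_inverse b c a = (THE y. is_bc_inverse b c a y)"

lemma is_bc_inverse_unique:
  assumes "is_bc_inverse b c a y" and "is_bc_inverse b c a z"
  shows "y = z"
proof -
  obtain w where w: "y = b * w * y" using assms(1) by (auto simp: is_bc_inverse_def)
  obtain v where v: "z = z * v * c" using assms(2) by (auto simp: is_bc_inverse_def)
  have b: "b = z * a * b" and c: "c = c * a * y"
    using assms by (auto simp: is_bc_inverse_def)
  have "y = z * a * (b * w * y)"
    using w b by (metis mult.assoc)
  then have "y = z * a * y" using w by simp
  moreover have "z = z * v * c * a * y" using v c by (metis mult.assoc)
  then have "z = z * a * y" using v by simp
  ultimately show ?thesis by simp
qed

lemma bc_inverse_eq:
  assumes "is_bc_inverse b c a y"
  shows "bc_inverse b c a = y"
  unfolding bc_inverse_def using assms is_bc_inverse_unique by blast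

text \<open>
  The library's \<open>inverse\<close> is only available in classes such as division rings, so the
  two-sided inverse in a monoid is introduced here; \<open>unit_inv x\<close> is unspecified when \<open>x\<close> is not
  a unit, so statements about it should be accompanied by \<open>x \<in> unit_elements\<close>.
\<close>

definition unit_elements :: "'a::monoid_mult set" where
  "unit_elements = {x. \<exists>y. x * y = 1 \<and> y * x = 1}"

definition unit_inv :: "'a::monoid_mult \<Rightarrow> 'a" where
  "unit_inv x = (THE y. x * y = 1 \<and> y * x = 1)"

lemma unit_inv_eq:
  fixes x y :: "'a::monoid_mult"
  assumes "x * y = 1" and "y * x = 1"
  shows "unit_inv x = y"
  unfolding unit_inv_def
proof (rule the_equality)
  show "z = y" if "x * z = 1 \<and> z * x = 1" for z
    using that assms by (metis mult.assoc mult.left_neutral mult.right_neutral)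
qed (use assms in simp)

end

theory Submission
  imports Defs
begin

text \<open>
  Let \<open>y\<close> be the \<open>(b,c)\<close>-inverse of \<open>a\<close>. If \<open>1 + y e\<close> is a unit, so is \<open>1 + e y\<close>, and the
  identity \<open>y (1 + e y) = (1 + y e) y\<close> gives \<open>(1 + y e)\<^sup>-\<^sup>1 y = y (1 + e y)\<^sup>-\<^sup>1\<close>. Writing this element \<open>z\<close> as
  \<open>(1 + y e)\<^sup>-\<^sup>1 y\<close> yields \<open>z (a + e) b = b\<close> and \<open>z \<in> z\<A>c\<close>, and writing it as
  \<open>y (1 + e y)\<^sup>-\<^sup>1\<close> yields \<open>c (a + e) z = c\<close> and \<open>z \<in> b\<A>z\<close>. Smallness of \<open>e\<close> makes \<open>1 + y e\<close> a
  unit by the Neumann series.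
\<close>

text \<open>The inverse is the geometric series \<open>s\<close>: shifting its index gives
  \<open>x * s = s * x = s - 1\<close>.\<close>

lemma one_minus_unit:
  fixes x :: "'a::{real_normed_algebra_1, banach}"
  assumes "norm x < 1"
  shows "1 - x \<in> unit_elements"
proof -
  have sm: "summable (\<lambda>n. x ^ n)"
    using assms by (rule complete_algebra_summable_geometric)
  define s where "s = (\<Sum>n. x ^ n)"
  have tail: "(\<Sum>n. x ^ Suc n) = s - 1"
    using suminf_split_head[OF sm] by (simp add: s_def)
  have "x * s = s - 1"
    using suminf_mult[OF sm, of x] tail by (simp add: s_def)
  moreover have "s * x = s - 1"
    using suminf_mult2[OF sm, of x] tail by (simp add: s_def power_commutes)
  ultimately have "(1 - x) * s = 1 \<and> s * (1 - x) = 1"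
    by (simp add: algebra_simps)
  then show ?thesis
    unfolding unit_elements_def by blast
qed

text \<open>Jacobson's lemma: \<open>1 - y * v * x\<close> is what the formal expansion of the
  inverse of \<open>1 + y * x\<close> suggests, since \<open>y\<close> and \<open>x\<close> can be
  pulled out around the series for \<open>v\<close>.\<close>

lemma inverse_one_plus_swap:
  fixes x y v :: "'a::ring_1"
  assumes "(1 + x * y) * v = 1" and "v * (1 + x * y) = 1"
  shows "(1 + y * x) * (1 - y * v * x) = 1" and "(1 - y * v * x) * (1 + y * x) = 1"
proof -
  have "(1 + y * x) * (1 - y * v * x) = 1 + y * x - y * ((1 + x * y) * v) * x"
    by (simp add: algebra_simps)
  then show "(1 + y * x) * (1 - y * v * x) = 1"
    using assms(1) by simp
  have "(1 - y * v * x) * (1 + y * x) = 1 + y * x - y * (v * (1 + x * y)) * x"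
    by (simp add: algebra_simps)
  then show "(1 - y * v * x) * (1 + y * x) = 1"
    using assms(2) by simp
qed

text \<open>The norm-free core. Sandwiching \<open>y * (1 + e * y) = (1 + y * e) * y\<close> between
  \<open>v\<close> and \<open>w\<close> needs only a left inverse on the left and a right inverse on
  the right.\<close>

lemma is_bc_inverse_add:
  fixes a b c e v w y :: "'a::ring_1"
  assumes y: "is_bc_inverse b c a y"
    and v: "v * (1 + y * e) = 1"
    and w: "(1 + e * y) * w = 1"
  shows "v * y = y * w" and "is_bc_inverse b c (a + e) (v * y)"
proof -
  obtain p q where p: "y = b * p * y" and q: "y = y * q * c"
    and b: "y * a * b = b" and c: "c * a * y = c"
    using y unfolding is_bc_inverse_def by auto
  have "v * y = v * (y * (1 + e * y)) * w"
    using w by (simp add: mult.assoc)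
  also have "y * (1 + e * y) = (1 + y * e) * y"
    by (simp add: algebra_simps)
  also have "v * \<dots> * w = v * (1 + y * e) * (y * w)"
    by (simp only: mult.assoc)
  also have "\<dots> = y * w"
    using v by simp
  finally show eq: "v * y = y * w" .
  have "v * y = b * p * (v * y)"
    unfolding eq using p by (metis mult.assoc)
  moreover have "v * y = v * y * q * c"
    using q by (metis mult.assoc)
  \<comment> \<open>Since \<open>y * a * b = b\<close>, the bracket equals
    \<open>(1 + y * e) * b\<close>, and \<open>v\<close> cancels the first factor.\<close>
  moreover have "v * y * (a + e) * b = v * (y * a * b + y * e * b)"
    by (simp add: algebra_simps)
  then have "v * y * (a + e) * b = v * (1 + y * e) * b"
    unfolding b by (simp add: algebra_simps)
  then have "v * y * (a + e) * b = b"
    using v by simp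
  moreover have "c * (a + e) * (y * w) = (c * a * y + c * e * y) * w"
    by (simp add: algebra_simps)
  then have "c * (a + e) * (y * w) = c * ((1 + e * y) * w)"
    unfolding c by (simp add: algebra_simps)
  then have "c * (a + e) * (v * y) = c"
    using w eq by simp
  ultimately show "is_bc_inverse b c (a + e) (v * y)"
    unfolding is_bc_inverse_def by auto
qed

text \<open>Bounding the product, rather than \<open>norm e\<close> by a quotient, also covers
  \<open>y = 0\<close>.\<close>

lemma bc_inverse_perturbation:
  fixes a b c e y :: "'a::{real_normed_algebra_1, banach}"
  assumes y: "is_bc_inverse b c a y" and small: "norm y * norm e < 1"
  shows "1 + y * e \<in> unit_elements" and "1 + e * y \<in> unit_elements"
    and "is_bc_inverse b c (a + e) (unit_inv (1 + y * e) * y)"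
    and "unit_inv (1 + y * e) * y = y * unit_inv (1 + e * y)"
proof -
  have "norm (- (y * e)) < 1"
    using norm_mult_ineq[of y e] small by simp
  from one_minus_unit[OF this] show u: "1 + y * e \<in> unit_elements"
    by simp
  then obtain v where v: "(1 + y * e) * v = 1" "v * (1 + y * e) = 1"
    unfolding unit_elements_def by blast
  note w = inverse_one_plus_swap[OF v]
  from w show "1 + e * y \<in> unit_elements"
    unfolding unit_elements_def by blast
  show "is_bc_inverse b c (a + e) (unit_inv (1 + y * e) * y)"
    and "unit_inv (1 + y * e) * y = y * unit_inv (1 + e * y)"
    unfolding unit_inv_eq[OF v] unit_inv_eq[OF w]
    using is_bc_inverse_add[OF y v(2) w(1)] by blast+
qed

lemma open_bc_invertibles:
  fixes b c :: "'a::{real_normed_algebra_1, banach}"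
  shows "open (bc_invertibles b c)"
  unfolding open_dist
proof
  fix a assume "a \<in> bc_invertibles b c"
  then obtain y where y: "is_bc_inverse b c a y"
    unfolding bc_invertibles_def by blast
  \<comment> \<open>The summand 1 covers \<open>y = 0\<close>, which occurs for \<open>b = c = 0\<close>.\<close>
  define r where "r = 1 / (norm y + 1)"
  have "r > 0"
    by (simp add: r_def add_nonneg_pos)
  moreover have "x \<in> bc_invertibles b c" if "dist x a < r" for x
  proof -
    have "norm (x - a) * (norm y + 1) < 1"
      using that by (simp add: r_def dist_norm pos_less_divide_eq add_nonneg_pos)
    then have "norm y * norm (x - a) + norm (x - a) < 1"
      by (simp add: algebra_simps)
    then have "norm y * norm (x - a) < 1"
      using norm_ge_zero[of "x - a"] by linarith
    \<comment> \<open>Here \<open>e\<close> is \<open>x - a\<close>, so that \<open>a + e\<close> is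
      \<open>x\<close>.\<close>
    from bc_inverse_perturbation(3)[OF y this] show ?thesis
      unfolding bc_invertibles_def by auto
  qed
  ultimately show "\<exists>r>0. \<forall>x. dist x a < r \<longrightarrow> x \<in> bc_invertibles b c"
    by blast
qed

text \<open>The two unit claims ensure that \<open>unit_inv\<close> denotes a genuine inverse in the
  formulas.\<close>

theorem theorem4p1:
  fixes b c :: "'a::{real_normed_algebra_1, banach}"
  shows "open (bc_invertibles b c) \<and>
    (b \<in> regular_elements - {0} \<longrightarrow> c \<in> regular_elements - {0} \<longrightarrow>
      (\<forall>a\<in>bc_invertibles b c. \<forall>e.
        norm e < 1 / norm (bc_inverse b c a) \<longrightarrow>
          a + e \<in> bc_invertibles b c \<and>
          1 + bc_inverse b c a * e \<in> unit_elements \<and>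
          1 + e * bc_inverse b c a \<in> unit_elements \<and>
          bc_inverse b c (a + e) = unit_inv (1 + bc_inverse b c a * e) * bc_inverse b c a \<and>
          bc_inverse b c (a + e) = bc_inverse b c a * unit_inv (1 + e * bc_inverse b c a)))"
proof (intro conjI impI ballI allI)
  show "open (bc_invertibles b c)"
    by (rule open_bc_invertibles)
next
  fix a e :: 'a
  assume "a \<in> bc_invertibles b c" and e: "norm e < 1 / norm (bc_inverse b c a)"
  then obtain y where y: "is_bc_inverse b c a y"
    unfolding bc_invertibles_def by blast
  note inv_a = bc_inverse_eq[OF y]
  \<comment> \<open>For \<open>y = 0\<close> the hypothesis on \<open>e\<close> reads \<open>norm e < 1 / 0 = 0\<close>.\<close>
  have "y \<noteq> 0"
    using e unfolding inv_a by auto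
  then have "norm y * norm e < 1"
    using e unfolding inv_a by (simp add: pos_less_divide_eq mult.commute)
  note pert = bc_inverse_perturbation[OF y this]
  note inv_ae = bc_inverse_eq[OF pert(3)]
  show "a + e \<in> bc_invertibles b c"
    unfolding bc_invertibles_def using pert(3) by blast
  show "1 + bc_inverse b c a * e \<in> unit_elements"
    and "1 + e * bc_inverse b c a \<in> unit_elements"
    and "bc_inverse b c (a + e) = unit_inv (1 + bc_inverse b c a * e) * bc_inverse b c a"
    and "bc_inverse b c (a + e) = bc_inverse b c a * unit_inv (1 + e * bc_inverse b c a)"
    unfolding inv_a inv_ae by (simp_all only: pert)
qed

end
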